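(* Let $\mathcal D$ be a domain of $\mathbb R^k$ and let $F:{}^1S^1\mathcal E(\mu)\times\mathcal D\to\mathbb R$, $(q,\eta,w,c)\mapsto F(q,\eta,w,c)$, be a smooth function. Then for every smooth curve $t\mapsto(q(t),\eta(t),w(t),c(t))\in{}^1S^1\mathcal E(\mu)\times\mathcal D$, $$\frac{d}{dt}F(q,\eta,w,c)=\langle\mathrm{Grad}\,F(q,\eta,w,c),\overset{\star}{q}\rangle_{q}+\left\langle\frac{D}{dt}\eta,\ \mathrm{Grad}_{m}F(q,\eta,w,c)\right\rangle_{q}+\left\langle\mathrm{Grad}_{e}F(q,\eta,w,c),\ \frac{D}{dt}w\right\rangle_{q}+\nabla F(q,\eta,w,c)\cdot\dot c,$$ where $q,\eta,w,c$ are evaluated at $t$, $\frac{D}{dt}\eta$ is the mixture covariant derivative, $\frac{D}{dt}w$ is the exponential covariant derivative, and: 1. $\mathrm{Grad}\,F(q,\eta,w,c)\in{}^*S_q\mathcal E(\mu)$ is the natural gradient of the function obtained by letting the base point vary while the fiber variables are transported from fixed ones, $q\mapsto F(q,{}^{m}\mathbb U_p^q\zeta,{}^{e}\mathbb U_p^q v,c)$; that is, for any $p\in\mathcal E(\mu)$, with $F_p(u,\zeta,v,c)=F\big(e_p(u),{}^{m}\mathbb U_p^{e_p(u)}\zeta,{}^{e}\mathbb U_p^{e_p(u)}v,c\big)$ and $q=e_p(u)$, $\eta={}^{m}\mathbb U_p^{q}\zeta$, $w={}^{e}\mathbb U_p^q v$, it is defined by $$\langle\mathrm{Grad}\,F(q,\eta,w,c),\overset{\star}{q}\rangle_q=D_1F_p(u,\zeta,v,c)\big[{}^{e}\mathbb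 U_q^p\overset{\star}{q}\big]\qquad\text{for all }\overset{\star}{q}\in S_q\mathcal E(\mu);$$ 2. $\mathrm{Grad}_{m}F(q,\eta,w,c)\in S_q\mathcal E(\mu)$ and $\mathrm{Grad}_{e}F(q,\eta,w,c)\in{}^*S_q\mathcal E(\mu)$ are the fiber gradients, i.e. for all $\alpha\in{}^*S_q\mathcal E(\mu)$, $\beta\in S_q\mathcal E(\mu)$, $$\left.\frac{d}{ds}F(q,\eta+s\alpha,w+s\beta,c)\right|_{s=0}=\langle\alpha,\mathrm{Grad}_{m}F(q,\eta,w,c)\rangle_q+\langle\mathrm{Grad}_{e}F(q,\eta,w,c),\beta\rangle_q;$$ 3. $\nabla F(q,\eta,w,c)\in\mathbb R^k$ is the Euclidean gradient with respect to the last variable $c$.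
   Context: $\Omega$ is a finite set with $N$ elements and $\mu$ is the uniform probability on $\Omega$. $\mathcal E(\mu)$ is the set of strictly positive probability densities with respect to $\mu$, i.e. functions $q:\Omega\to(0,\infty)$ with $\sum_{x}q(x)=N$. For $f:\Omega\to\mathbb R$, $\mathbb E_q[f]=\frac1N\sum_x f(x)q(x)$. For $q\in\mathcal E(\mu)$ the exponential fiber $S_q\mathcal E(\mu)$ and the mixture fiber ${}^*S_q\mathcal E(\mu)$ are both equal, as vector spaces, to $\{v:\Omega\to\mathbb R : \mathbb E_q[v]=0\}$, with duality pairing $\langle\eta,v\rangle_q=\mathbb E_q[\eta v]$ for $\eta\in{}^*S_q\mathcal E(\mu)$, $v\in S_q\mathcal E(\mu)$. The full bundle is ${}^1S^1\mathcal E(\mu)=\{(q,\eta,w): q\in\mathcal E(\mu),\eta\in{}^*S_q\mathcal E(\mu),w\in S_q\mathcal E(\mu)\}$, with the manifold structure induced from its embedding in $(\mathbb R^\Omega)^3$. The exponential transport is ${}^{e}\mathbb U_p^q v=v-\mathbb E_q[v]$ from $S_p\mathcal E(\mu)$ to $S_q\mathcal E(\mu)$; the mixture transport is ${}^{m}\mathbb U_p^q\eta=\frac pq\,\eta$ from ${}^*S_p\mathcal E(\mu)$ to ${}^*S_q\mathcal E(\mu)$. For $p\in\mathcal E(\mu)$ and $u\in S_p\mathcal E(\mu)$, $K_p(u)=\log\mathbb E_p[e^u]$ and $e_p(u)=e^{u-K_p(u)}\,p\in\mathcal E(\mu)$; $e_p:S_p\mathcal E(\mu)\to\mathcal E(\mu)$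 is a bijection with inverse $s_p(q)=\log\frac qp-\mathbb E_p[\log\frac qp]$. $D_1F_p$ denotes the differential of $F_p$ with respect to its first variable $u\in S_p\mathcal E(\mu)$. A dot denotes the ordinary time derivative. The velocity of a smooth curve $q(t)$ in $\mathcal E(\mu)$ is $\overset{\star}{q}(t)=\dot q(t)/q(t)\in S_{q(t)}\mathcal E(\mu)$. The natural gradient of $G:\mathcal E(\mu)\to\mathbb R$ is the section $q\mapsto\mathrm{Grad}\,G(q)\in{}^*S_q\mathcal E(\mu)$ such that $\frac{d}{dt}G(q(t))=\langle\mathrm{Grad}\,G(q(t)),\overset{\star}{q}(t)\rangle_{q(t)}$ for every smooth curve. The exponential covariant derivative of $w(t)\in S_{q(t)}\mathcal E(\mu)$ is $\frac{D}{dt}w=\dot w-\mathbb E_{q(t)}[\dot w]$; the mixture covariant derivative of $\eta(t)\in{}^*S_{q(t)}\mathcal E(\mu)$ is $\frac{D}{dt}\eta=\overset{\star}{q}\,\eta+\dot\eta$. *)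

theory Defs
  imports "HOL-Analysis.Analysis"
begin

text \<open>
  The finite sample space is the type \<open>'n\<close> and functions on it are vectors in \<open>real ^ 'n\<close>, so that
  they carry the topology and differential calculus of a Euclidean space.
\<close>

section \<open>Smooth maps\<close>

text \<open>\<open>Ck_on n f U\<close>: \<open>f\<close> is of class \<open>C\<^sup>n\<close> on the open set \<open>U\<close> (finite-dimensional domain).\<close>

primrec Ck_on ::
    "nat \<Rightarrow> ('a::real_normed_vector \<Rightarrow> 'b::real_normed_vector) \<Rightarrow> 'a set \<Rightarrow> bool" where
  "Ck_on 0 f U \<longleftrightarrow> continuous_on U f"
| "Ck_on (Suc n) f U \<longleftrightarrow>
     (\<forall>x\<in>U. f differentiable (at x)) \<and> (\<forall>h. Ck_on n (\<lambda>x. frechet_derivative f (at x) h) U)"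

text \<open>
  A map on an arbitrary subset \<open>M\<close> of a Euclidean space is smooth if near each point of \<open>M\<close> it
  extends to a \<open>C\<^sup>\<infinity>\<close> map on an open subset of the ambient space.  For an embedded submanifold this is
  smoothness for the induced manifold structure; for open \<open>M\<close> it is ordinary smoothness.
\<close>

definition smooth_on :: "('a::euclidean_space \<Rightarrow> 'b::euclidean_space) \<Rightarrow> 'a set \<Rightarrow> bool" where
  "smooth_on f M \<longleftrightarrow>
     (\<forall>x\<in>M. \<exists>U g. open U \<and> x \<in> U \<and> (\<forall>n. Ck_on n g U) \<and> (\<forall>y\<in>M \<inter> U. f y = g y))"

definition smooth_curve :: "real set \<Rightarrow> (real \<Rightarrow> 'a::euclidean_space) \<Rightarrow> 'a set \<Rightarrow> bool" where
  "smooth_curve I \<gamma> M \<longleftrightarrow> open I \<and> is_interval I \<and> smooth_on \<gamma> I \<and> (\<forall>t\<in>I. \<gamma> t \<in> M)"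

section \<open>The statistical bundle\<close>

definition expect :: "real ^ 'n::finite \<Rightarrow> real ^ 'n \<Rightarrow> real" where
  "expect q f = (\<Sum>x\<in>UNIV. f $ x * q $ x) / real CARD('n)"

definition densities :: "(real ^ 'n::finite) set" where
  "densities = {q. (\<forall>x. 0 < q $ x) \<and> (\<Sum>x\<in>UNIV. q $ x) = real CARD('n)}"

text \<open>The exponential and the mixture fiber at \<open>q\<close> are this same vector space.\<close>

definition fiber :: "real ^ 'n::finite \<Rightarrow> (real ^ 'n) set" where
  "fiber q = {v. expect q v = 0}"

definition pairing :: "real ^ 'n::finite \<Rightarrow> real ^ 'n \<Rightarrow> real ^ 'n \<Rightarrow> real" where
  "pairing q \<eta> v = expect q (\<chi> x. \<eta> $ x * v $ x)"

definition full_bundle :: "((real ^ 'n::finite) \<times> (real ^ 'n) \<times> (real ^ 'n)) set" where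
  "full_bundle = {(q, \<eta>, w). q \<in> densities \<and> \<eta> \<in> fiber q \<and> w \<in> fiber q}"

text \<open>\<open>exp_transport p q\<close> and \<open>mix_transport p q\<close> map the fiber at \<open>p\<close> to the fiber at \<open>q\<close>.\<close>

definition exp_transport :: "real ^ 'n::finite \<Rightarrow> real ^ 'n \<Rightarrow> real ^ 'n \<Rightarrow> real ^ 'n" where
  "exp_transport p q v = (\<chi> x. v $ x - expect q v)"

definition mix_transport :: "real ^ 'n::finite \<Rightarrow> real ^ 'n \<Rightarrow> real ^ 'n \<Rightarrow> real ^ 'n" where
  "mix_transport p q \<eta> = (\<chi> x. p $ x / q $ x * \<eta> $ x)"

definition cumulant :: "real ^ 'n::finite \<Rightarrow> real ^ 'n \<Rightarrow> real" where
  "cumulant p u = ln (expect p (\<chi> x. exp (u $ x)))"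

definition exp_param :: "real ^ 'n::finite \<Rightarrow> real ^ 'n \<Rightarrow> real ^ 'n" where
  "exp_param p u = (\<chi> x. exp (u $ x - cumulant p u) * p $ x)"

section \<open>Velocities and covariant derivatives along curves\<close>

definition velocity :: "(real \<Rightarrow> real ^ 'n::finite) \<Rightarrow> real \<Rightarrow> real ^ 'n" where
  "velocity q t = (\<chi> x. vector_derivative q (at t) $ x / q t $ x)"

definition exp_covariant ::
    "(real \<Rightarrow> real ^ 'n::finite) \<Rightarrow> (real \<Rightarrow> real ^ 'n) \<Rightarrow> real \<Rightarrow> real ^ 'n" where
  "exp_covariant q w t =
     (\<chi> x. vector_derivative w (at t) $ x - expect (q t) (vector_derivative w (at t)))"

definition mix_covariant ::
    "(real \<Rightarrow> real ^ 'n::finite) \<Rightarrow> (real \<Rightarrow> real ^ 'n) \<Rightarrow> real \<Rightarrow> real ^ 'n" where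
  "mix_covariant q \<eta> t =
     (\<chi> x. velocity q t $ x * \<eta> t $ x + vector_derivative \<eta> (at t) $ x)"

section \<open>Gradients\<close>

definition natural_gradient ::
    "(real ^ 'n::finite \<Rightarrow> real) \<Rightarrow> (real ^ 'n \<Rightarrow> real ^ 'n) \<Rightarrow> bool" where
  "natural_gradient G grad \<longleftrightarrow>
     (\<forall>q\<in>densities. grad q \<in> fiber q) \<and>
     (\<forall>I q. smooth_curve I q densities \<longrightarrow>
        (\<forall>t\<in>I. ((\<lambda>s. G (q s)) has_real_derivative
                  pairing (q t) (grad (q t)) (velocity q t)) (at t)))"

type_synonym ('n, 'k) bundle_fun =
  "real ^ 'n \<Rightarrow> real ^ 'n \<Rightarrow> real ^ 'n \<Rightarrow> real ^ 'k \<Rightarrow> real"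

definition in_chart ::
    "('n::finite, 'k::finite) bundle_fun \<Rightarrow> real ^ 'n \<Rightarrow> ('n, 'k) bundle_fun" where
  "in_chart F p u \<zeta> v c =
     F (exp_param p u) (mix_transport p (exp_param p u) \<zeta>) (exp_transport p (exp_param p u) v) c"

text \<open>
  The differential in the chart variable \<open>u\<close> is taken along the linear subspace \<open>fiber p\<close>: the
  derivative \<open>L\<close> within \<open>fiber p\<close> is determined on \<open>fiber p\<close> only, and it is evaluated only there.
\<close>

definition base_gradient ::
    "('n::finite, 'k::finite) bundle_fun \<Rightarrow> real ^ 'n \<Rightarrow> real ^ 'n \<Rightarrow> real ^ 'n \<Rightarrow> real ^ 'k
      \<Rightarrow> real ^ 'n \<Rightarrow> bool" where
  "base_gradient F q \<eta> w c g \<longleftrightarrow>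
     g \<in> fiber q \<and>
     (\<forall>p\<in>densities. \<forall>u\<in>fiber p. \<forall>\<zeta>\<in>fiber p. \<forall>v\<in>fiber p.
        q = exp_param p u \<and> \<eta> = mix_transport p q \<zeta> \<and> w = exp_transport p q v \<longrightarrow>
        (\<exists>L. ((\<lambda>u'. in_chart F p u' \<zeta> v c) has_derivative L) (at u within fiber p) \<and>
             (\<forall>h\<in>fiber q. pairing q g h = L (exp_transport q p h))))"

definition fiber_gradients ::
    "('n::finite, 'k::finite) bundle_fun \<Rightarrow> real ^ 'n \<Rightarrow> real ^ 'n \<Rightarrow> real ^ 'n \<Rightarrow> real ^ 'k
      \<Rightarrow> (real ^ 'n) \<times> (real ^ 'n) \<Rightarrow> bool" where
  "fiber_gradients F q \<eta> w c = (\<lambda>(gm, ge).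
     gm \<in> fiber q \<and> ge \<in> fiber q \<and>
     (\<forall>\<alpha>\<in>fiber q. \<forall>\<beta>\<in>fiber q.
        ((\<lambda>s. F q (\<eta> + s *\<^sub>R \<alpha>) (w + s *\<^sub>R \<beta>) c) has_real_derivative
           pairing q \<alpha> gm + pairing q ge \<beta>) (at 0)))"

definition Grad ::
    "('n::finite, 'k::finite) bundle_fun \<Rightarrow> real ^ 'n \<Rightarrow> real ^ 'n \<Rightarrow> real ^ 'n \<Rightarrow> real ^ 'k
      \<Rightarrow> real ^ 'n" where
  "Grad F q \<eta> w c = (THE g. base_gradient F q \<eta> w c g)"

definition Grad_m ::
    "('n::finite, 'k::finite) bundle_fun \<Rightarrow> real ^ 'n \<Rightarrow> real ^ 'n \<Rightarrow> real ^ 'n \<Rightarrow> real ^ 'k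
      \<Rightarrow> real ^ 'n" where
  "Grad_m F q \<eta> w c = fst (THE gs. fiber_gradients F q \<eta> w c gs)"

definition Grad_e ::
    "('n::finite, 'k::finite) bundle_fun \<Rightarrow> real ^ 'n \<Rightarrow> real ^ 'n \<Rightarrow> real ^ 'n \<Rightarrow> real ^ 'k
      \<Rightarrow> real ^ 'n" where
  "Grad_e F q \<eta> w c = snd (THE gs. fiber_gradients F q \<eta> w c gs)"

definition nabla ::
    "('n::finite, 'k::finite) bundle_fun \<Rightarrow> real ^ 'n \<Rightarrow> real ^ 'n \<Rightarrow> real ^ 'n \<Rightarrow> real ^ 'k
      \<Rightarrow> real ^ 'k" where
  "nabla F q \<eta> w c = (THE g. GDERIV (F q \<eta> w) c :> g)"

end

theory Submission
  imports Defs
begin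

text \<open>
  A smooth function \<open>F\<close> on the bundle has at each point a differential \<open>G\<close> within
  \<open>full_bundle \<times> D\<close>, inherited from a local extension, and everything is read off from this one
  linear map by the chain rule.

  The tangent space at \<open>((q, \<eta>, w), c)\<close> splits. A score \<open>h\<close> in the fiber at \<open>q\<close> has a horizontal
  lift: the velocity of the bundle curve obtained when \<open>q\<close> moves with velocity \<open>h\<close> while \<open>\<eta>\<close> follows
  the mixture transport and \<open>w\<close> the exponential transport. Differentiating these transports gives
  \<open>(q h, - \<eta> h, - expect q (w h))\<close>, the last entry being a constant function
  (\<open>has_derivative_transport\<close>). The formula mentions neither the origin of the transports nor a chart,
  and this is why \<open>Grad F\<close> is well defined: in every exponential chart its defining condition says
  that it represents \<open>h \<mapsto> G (lift h, 0)\<close> (\<open>base_gradient_iff\<close>). In the same way the fiber gradients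
  and \<open>nabla\<close> represent the restrictions of \<open>G\<close> to the vertical directions and to the parameter
  directions. The pairing is an inner product on the fiber, so the gradients in the fiber exist
  and are unique by the Riesz representation (\<open>fiber_Riesz\<close>); for \<open>nabla\<close> the Euclidean inner
  product plays this part.

  The velocity of an arbitrary bundle curve is the horizontal lift of the velocity of \<open>q\<close> plus
  vertical remainders, and these are the mixture and the exponential covariant derivatives
  (\<open>bundle_curve_derivative\<close>). Applying \<open>G\<close> to this sum gives the formula. Transported fiber
  variables have horizontal velocity, which gives the natural gradient property.
\<close>

section \<open>The fibers as inner product spaces\<close>

lemma expect_inner: "expect q f = (f \<bullet> q) / real CARD('n)" for q f :: "real ^ 'n::finite"
  by (simp add: expect_def inner_vec_def)

lemma expect_algebra:
  fixes q f g :: "real ^ 'n::finite"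
  shows "expect q (f + g) = expect q f + expect q g"
    and "expect q (f - g) = expect q f - expect q g"
    and "expect q (a *\<^sub>R f) = a * expect q f"
    and "expect q 0 = 0"
  by (simp_all add: expect_inner inner_add_left inner_diff_left add_divide_distrib diff_divide_distrib)

lemma pairing_algebra:
  fixes q f g h :: "real ^ 'n::finite"
  shows "pairing q (f + g) h = pairing q f h + pairing q g h"
    and "pairing q (f - g) h = pairing q f h - pairing q g h"
    and "pairing q (a *\<^sub>R f) h = a * pairing q f h"
    and "pairing q 0 h = 0"
  by (simp_all add: pairing_def expect_def algebra_simps sum.distrib sum_subtractf
        sum_distrib_left sum_distrib_right add_divide_distrib diff_divide_distrib)

lemma pairing_commute: "pairing q f g = pairing q g f"
  by (simp add: pairing_def mult.commute)

lemma densities_pos: "q \<in> densities \<Longrightarrow> 0 < q $ x"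
  by (simp add: densities_def)

lemma expect_const: "q \<in> densities \<Longrightarrow> expect q (\<chi> x. a) = a" for q :: "real ^ 'n::finite"
  by (simp add: densities_def expect_def sum_distrib_left[symmetric])

lemma exp_transport_diff: "exp_transport p q v = v - (\<chi> x. expect q v)"
  by (simp add: exp_transport_def vec_eq_iff)

lemma exp_transport_in_fiber:
  assumes "q \<in> densities"
  shows "exp_transport p q v \<in> fiber q"
  using assms by (simp add: exp_transport_diff fiber_def expect_algebra expect_const)

lemma mix_transport_in_fiber:
  fixes p q \<zeta> :: "real ^ 'n::finite"
  assumes "q \<in> densities" "\<zeta> \<in> fiber p"
  shows "mix_transport p q \<zeta> \<in> fiber q"
proof -
  have "p $ x / q $ x * \<zeta> $ x * q $ x = \<zeta> $ x * p $ x" for x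
    using densities_pos[OF assms(1), of x] by simp
  then show ?thesis
    using assms(2) by (simp add: fiber_def expect_def mix_transport_def)
qed

lemma exp_transport_cancel:
  assumes "q \<in> densities" "h \<in> fiber q"
  shows "exp_transport p q (exp_transport q p h) = h"
  using assms
  by (simp add: exp_transport_diff expect_algebra expect_const fiber_def) (simp add: vec_eq_iff)

lemma exp_transport_self: "v \<in> fiber q \<Longrightarrow> exp_transport q q v = v"
  by (simp add: exp_transport_def fiber_def vec_eq_iff)

lemma mix_transport_self: "q \<in> densities \<Longrightarrow> mix_transport q q \<zeta> = \<zeta>"
  by (simp add: mix_transport_def vec_eq_iff densities_def)
    (metis less_irrefl)

text \<open>Additive constants are orthogonal to the fiber, so exponential transport cannot be seen by
  the pairing.\<close>

lemma pairing_exp_transport: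
  assumes "h \<in> fiber q"
  shows "pairing q (exp_transport p q v) h = pairing q v h"
proof -
  have "pairing q (\<chi> x. a) h = 0" for a
    using assms by (simp add: pairing_def fiber_def expect_def mult.assoc sum_distrib_left[symmetric])
  then show ?thesis by (simp add: exp_transport_diff pairing_algebra)
qed

lemma pairing_self_eq_0:
  assumes q: "q \<in> densities" and "pairing q g g = 0"
  shows "g = 0"
proof -
  have "(\<Sum>x\<in>UNIV. (g $ x)\<^sup>2 * q $ x) = 0"
    using assms(2) by (simp add: pairing_def expect_def power2_eq_square)
  moreover have "0 \<le> (g $ x)\<^sup>2 * q $ x" for x
    using densities_pos[OF q, of x] by simp
  ultimately have "\<forall>x\<in>UNIV. (g $ x)\<^sup>2 * q $ x = 0"
    by (simp add: sum_nonneg_eq_0_iff del: mult_eq_0_iff)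
  then show ?thesis
    using densities_pos[OF q] by (simp add: vec_eq_iff) (metis less_irrefl)
qed

text \<open>Riesz representation. A linear functional with coordinates \<open>a\<close> is represented on the whole
  space by \<open>N a / q\<close>; removing the mean of this vector projects it onto the fiber and does not
  change its pairing with fiber elements.\<close>

lemma fiber_Riesz:
  fixes \<Lambda> :: "real ^ 'n::finite \<Rightarrow> real"
  assumes q: "q \<in> densities" and lin: "linear \<Lambda>"
  shows "\<exists>!g. g \<in> fiber q \<and> (\<forall>h\<in>fiber q. pairing q g h = \<Lambda> h)"
proof (rule ex_ex1I)
  define a where "a = adjoint \<Lambda> 1"
  define g\<^sub>0 where "g\<^sub>0 = (\<chi> x. real CARD('n) * a $ x / q $ x)"
  have "pairing q g\<^sub>0 h = \<Lambda> h" for h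
  proof -
    have "g\<^sub>0 $ x * h $ x * q $ x = real CARD('n) * (h $ x * a $ x)" for x
      using densities_pos[OF q, of x] by (simp add: g\<^sub>0_def)
    then have "pairing q g\<^sub>0 h = (\<Sum>x\<in>UNIV. real CARD('n) * (h $ x * a $ x)) / real CARD('n)"
      by (simp only: pairing_def expect_def vec_lambda_beta)
    also have "\<dots> = h \<bullet> a"
      by (simp add: sum_distrib_left[symmetric] inner_vec_def)
    also have "\<dots> = \<Lambda> h"
      using adjoint_works[OF lin, of h 1] by (simp add: a_def)
    finally show ?thesis .
  qed
  then have "exp_transport q q g\<^sub>0 \<in> fiber q \<and>
      (\<forall>h\<in>fiber q. pairing q (exp_transport q q g\<^sub>0) h = \<Lambda> h)"
    using q by (simp add: exp_transport_in_fiber pairing_exp_transport)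
  then show "\<exists>g. g \<in> fiber q \<and> (\<forall>h\<in>fiber q. pairing q g h = \<Lambda> h)" ..
next
  fix g g'
  assume g: "g \<in> fiber q \<and> (\<forall>h\<in>fiber q. pairing q g h = \<Lambda> h)"
    and g': "g' \<in> fiber q \<and> (\<forall>h\<in>fiber q. pairing q g' h = \<Lambda> h)"
  have "g - g' \<in> fiber q"
    using g g' by (simp add: fiber_def expect_algebra)
  then have "pairing q (g - g') (g - g') = 0"
    using g g' by (simp add: pairing_algebra(2))
  then show "g = g'"
    using pairing_self_eq_0[OF q] by force
qed

text \<open>The pairing turns the derivative \<open>q'\<close> of a density, divided by the density, into a Fisher
  score.\<close>

lemma expect_pairing:
  assumes "q \<in> densities"
  shows "expect q' f = pairing q f (\<chi> x. q' $ x / q $ x)"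
proof -
  have "f $ x * q' $ x = f $ x * (q' $ x / q $ x) * q $ x" for x
    using densities_pos[OF assms, of x] by simp
  then show ?thesis by (simp only: pairing_def expect_def vec_lambda_beta)
qed

section \<open>Parallel transport to first order\<close>

text \<open>The velocity in \<open>(\<real>\<^sup>n)\<^sup>3\<close> of the bundle curve obtained by carrying \<open>(\<eta>, w)\<close> along a curve of
  densities by the mixture and the exponential transport, when the base curve leaves \<open>q\<close> with
  velocity \<open>h\<close>; its values span the horizontal space of the product connection.\<close>

definition horizontal_lift ::
    "real ^ 'n::finite \<Rightarrow> real ^ 'n \<Rightarrow> real ^ 'n \<Rightarrow> real ^ 'n
      \<Rightarrow> (real ^ 'n) \<times> (real ^ 'n) \<times> (real ^ 'n)" where
  "horizontal_lift q \<eta> w h =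
     ((\<chi> x. q $ x * h $ x), (\<chi> x. - (\<eta> $ x * h $ x)), (\<chi> x. - pairing q w h))"

lemma linear_horizontal_lift: "linear (horizontal_lift q \<eta> w)"
  by (rule linearI)
    (simp_all add: horizontal_lift_def vec_eq_iff algebra_simps pairing_algebra
      pairing_commute[of q w])

lemma has_derivative_vec_lambda_within:
  fixes f :: "'n::finite \<Rightarrow> 'a::real_normed_vector \<Rightarrow> real"
  assumes "\<And>i. (f i has_derivative f' i) (at x within S)"
  shows "((\<lambda>x. \<chi> i. f i x) has_derivative (\<lambda>h. \<chi> i. f' i h)) (at x within S)"
proof -
  have "((\<lambda>x. (\<chi> i. f i x) \<bullet> b) has_derivative (\<lambda>h. (\<chi> i. f' i h) \<bullet> b)) (at x within S)"
    if "b \<in> Basis" for b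
    using that assms by (auto simp: Basis_vec_def inner_axis intro: has_derivative_inner_left)
  then show ?thesis
    by (subst has_derivative_componentwise_within) blast
qed

lemma has_derivative_expect:
  fixes f f' :: "'a::real_normed_vector \<Rightarrow> real ^ 'n::finite"
  assumes "(Q has_derivative Q') (at x within S)" "(f has_derivative f') (at x within S)"
  shows "((\<lambda>x. expect (Q x) (f x)) has_derivative
            (\<lambda>h. expect (Q x) (f' h) + expect (Q' h) (f x))) (at x within S)"
  unfolding expect_inner divide_inverse distrib_right[symmetric]
  by (intro has_derivative_mult_left)
    (use has_derivative_inner[OF assms(2,1)] in \<open>simp add: add.commute\<close>)

lemma has_derivative_vec_nth':
  "(Q has_derivative Q') F \<Longrightarrow> ((\<lambda>x. Q x $ i) has_derivative (\<lambda>h. Q' h $ i)) F"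
  by (rule bounded_linear.has_derivative[OF bounded_linear_vec_nth])

text \<open>Since \<open>\<eta> = p \<zeta> / q\<close>, the logarithmic derivative of the mixture transport is minus the score; the
  exponential transport changes only by the constant \<open>- expect q v\<close>, and replacing \<open>v\<close> by its
  transported value in the derivative of this mean is harmless because scores have mean zero. The
  parameter space is arbitrary so that one computation serves both curves and charts.\<close>

lemma has_derivative_transport:
  fixes Q :: "'a::real_normed_vector \<Rightarrow> real ^ 'n::finite"
  assumes Q: "(Q has_derivative Q') (at t within S)" and q: "Q t \<in> densities"
    and tangent: "\<And>h. (\<chi> x. Q' h $ x / Q t $ x) \<in> fiber (Q t)"
  shows "((\<lambda>s. (Q s, mix_transport p (Q s) \<zeta>, exp_transport p (Q s) v)) has_derivative
            (\<lambda>h. horizontal_lift (Q t) (mix_transport p (Q t) \<zeta>) (exp_transport p (Q t) v)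
                   (\<chi> x. Q' h $ x / Q t $ x))) (at t within S)"
proof -
  have pos: "Q t $ x \<noteq> 0" for x
    using densities_pos[OF q, of x] by simp
  have Qx: "((\<lambda>s. Q s $ x) has_derivative (\<lambda>h. Q' h $ x)) (at t within S)" for x
    by (rule has_derivative_vec_nth'[OF Q])
  have mix: "((\<lambda>s. mix_transport p (Q s) \<zeta>) has_derivative
      (\<lambda>h. \<chi> x. - (mix_transport p (Q t) \<zeta> $ x * (Q' h $ x / Q t $ x)))) (at t within S)"
    unfolding mix_transport_def
    by (rule has_derivative_vec_lambda_within)
       (auto intro!: derivative_eq_intros Qx simp: pos field_simps power2_eq_square)
  have "((\<lambda>s. expect (Q s) v) has_derivative (\<lambda>h. expect (Q' h) v)) (at t within S)"
    using has_derivative_expect[OF Q has_derivative_const[of v]] by (simp add: expect_algebra)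
  moreover have "expect (Q' h) v = pairing (Q t) (exp_transport p (Q t) v) (\<chi> x. Q' h $ x / Q t $ x)"
    for h
    unfolding pairing_exp_transport[OF tangent] by (rule expect_pairing[OF q])
  ultimately have "((\<lambda>s. v $ x - expect (Q s) v) has_derivative
      (\<lambda>h. - pairing (Q t) (exp_transport p (Q t) v) (\<chi> x. Q' h $ x / Q t $ x))) (at t within S)"
    for x
    by (auto intro!: derivative_eq_intros)
  then have ex: "((\<lambda>s. exp_transport p (Q s) v) has_derivative
      (\<lambda>h. \<chi> x. - pairing (Q t) (exp_transport p (Q t) v) (\<chi> x. Q' h $ x / Q t $ x)))
        (at t within S)"
    unfolding exp_transport_def[of p _ v] by (intro has_derivative_vec_lambda_within)
  have "Q' = (\<lambda>h. \<chi> x. Q t $ x * (Q' h $ x / Q t $ x))"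
    using pos by (simp add: vec_eq_iff fun_eq_iff)
  with Q have "(Q has_derivative (\<lambda>h. \<chi> x. Q t $ x * (Q' h $ x / Q t $ x))) (at t within S)"
    by simp
  from has_derivative_Pair[OF this has_derivative_Pair[OF mix ex]]
  show ?thesis by (simp add: horizontal_lift_def)
qed

section \<open>The exponential chart\<close>

lemma expect_exp_pos:
  fixes p u :: "real ^ 'n::finite"
  assumes "p \<in> densities"
  shows "0 < expect p (\<chi> x. exp (u $ x))"
  unfolding expect_def
  by (intro divide_pos_pos sum_pos) (auto simp: densities_pos[OF assms])

lemma exp_param_eq:
  assumes "p \<in> densities"
  shows "exp_param p u = (\<chi> x. exp (u $ x) * p $ x / expect p (\<chi> x. exp (u $ x)))"
  using expect_exp_pos[OF assms, of u]
  by (simp add: exp_param_def cumulant_def exp_diff vec_eq_iff)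

lemma exp_param_in_densities:
  fixes p u :: "real ^ 'n::finite"
  assumes p: "p \<in> densities"
  shows "exp_param p u \<in> densities"
proof -
  have "(\<Sum>x\<in>UNIV. exp (u $ x) * p $ x) = real CARD('n) * expect p (\<chi> x. exp (u $ x))"
    by (simp add: expect_def)
  then show ?thesis
    using expect_exp_pos[OF p, of u] densities_pos[OF p]
    by (simp add: densities_def exp_param_eq[OF p] sum_divide_distrib[symmetric])
qed

lemma exp_param_0: "p \<in> densities \<Longrightarrow> exp_param p 0 = p"
  by (simp add: exp_param_eq expect_const vec_eq_iff)

text \<open>The cumulant has derivative \<open>expect q h\<close> at \<open>u\<close>, so the score of the chart in direction \<open>h\<close> is
  \<open>h - expect q h\<close>, the exponential transport of \<open>h\<close>.\<close>

lemma exp_param_has_derivative: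
  fixes p u :: "real ^ 'n::finite"
  assumes p: "p \<in> densities"
  defines "q \<equiv> exp_param p u"
  shows "(exp_param p has_derivative (\<lambda>h. \<chi> x. q $ x * exp_transport p q h $ x)) (at u)"
proof -
  let ?Z = "\<lambda>u. expect p (\<chi> x. exp (u $ x))"
  have Z: "?Z u > 0" by (rule expect_exp_pos[OF p])
  have ux: "((\<lambda>u. exp (u $ x)) has_derivative (\<lambda>h. exp (u $ x) * h $ x)) (at u)"
    for u :: "real ^ 'n" and x
    by (rule has_derivative_eq_rhs[OF has_derivative_exp[OF has_derivative_vec_nth'[OF has_derivative_ident]]])
      (simp add: mult.commute)
  have "(?Z has_derivative (\<lambda>h. expect p (\<chi> x. exp (u $ x) * h $ x))) (at u)"
    using has_derivative_expect[OF has_derivative_const[of p]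
        has_derivative_vec_lambda_within[OF ux]]
    by (simp add: expect_inner)
  moreover have "expect p (\<chi> x. exp (u $ x) * h $ x) = ?Z u * expect q h" for h
  proof -
    have "h $ x * q $ x = exp (u $ x) * h $ x * p $ x / ?Z u" for x
      by (simp add: q_def exp_param_eq[OF p])
    then have "(\<Sum>x\<in>UNIV. h $ x * q $ x) = (\<Sum>x\<in>UNIV. exp (u $ x) * h $ x * p $ x) / ?Z u"
      by (simp only: sum_divide_distrib)
    then show ?thesis using Z by (simp add: expect_def[of q h] expect_def[of p "\<chi> x. _ x * _ x"])
  qed
  ultimately have dZ: "(?Z has_derivative (\<lambda>h. ?Z u * expect q h)) (at u)" by simp
  have "((\<lambda>u. exp (u $ x) * p $ x / ?Z u) has_derivative
      (\<lambda>h. q $ x * exp_transport p q h $ x)) (at u)" for x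
    using Z
    by (auto intro!: derivative_eq_intros has_derivative_vec_nth'[OF has_derivative_ident] dZ
        simp: q_def exp_param_eq[OF p] exp_transport_def field_simps)
  then show ?thesis
    by (subst exp_param_eq[OF p, abs_def]) (rule has_derivative_vec_lambda_within)
qed

section \<open>Gradients as parts of one differential\<close>

text \<open>Smoothness on the bundle provides a local extension to the ambient space. Its differential is a
  differential of the function itself within the bundle; it need not be unique, but only its values
  on directions tangent to the bundle will be used.\<close>

lemma smooth_on_has_derivative:
  assumes "smooth_on f M" "x \<in> M"
  obtains G where "(f has_derivative G) (at x within M)"
proof -
  obtain U g where U: "open U" "x \<in> U" and g: "\<And>n. Ck_on n g U" and fg: "\<forall>y\<in>M \<inter> U. f y = g y"
    using assms unfolding smooth_on_def by blast
  have "g differentiable (at x)"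
    using g[of "Suc 0"] U(2) by simp
  then obtain G where "(g has_derivative G) (at x)"
    unfolding differentiable_def by blast
  then have "(g has_derivative G) (at x within M \<inter> U)"
    by (rule has_derivative_at_withinI)
  then have "(f has_derivative G) (at x within M \<inter> U)"
    by (rule has_derivative_transform[rotated 2]) (use assms U fg in auto)
  moreover have "at x within M \<inter> U = at x within M"
    using U by (intro at_within_nhd[of _ U]) auto
  ultimately show ?thesis using that by simp
qed


lemma has_derivative_along:
  assumes "(f has_derivative G) (at (\<gamma> t) within M)" "(\<gamma> has_derivative \<gamma>') (at t within S)"
    and "\<gamma> ` S \<subseteq> M"
  shows "((\<lambda>s. f (\<gamma> s)) has_derivative (\<lambda>h. G (\<gamma>' h))) (at t within S)"
  by (rule has_derivative_in_compose[OF assms(2) has_derivative_subset[OF assms(1,3)]])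

text \<open>A differential within \<open>fiber p\<close> is determined in the directions of \<open>fiber p\<close>, because lines
  with such directions stay in it.\<close>

lemma has_derivative_fiber_unique:
  fixes f :: "real ^ 'n::finite \<Rightarrow> real"
  assumes L: "(f has_derivative L) (at u within fiber p)"
    and L': "(f has_derivative L') (at u within fiber p)"
    and u: "u \<in> fiber p" and h: "h \<in> fiber p"
  shows "L h = L' h"
proof -
  let ?\<gamma> = "\<lambda>s::real. u + s *\<^sub>R h"
  have \<gamma>: "(?\<gamma> has_derivative (\<lambda>s. s *\<^sub>R h)) (at 0)"
    by (auto intro!: derivative_eq_intros)
  have "range ?\<gamma> \<subseteq> fiber p"
    using u h by (auto simp: fiber_def expect_algebra)
  then have "((\<lambda>s. f (?\<gamma> s)) has_derivative (\<lambda>s. M (s *\<^sub>R h))) (at 0)"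
    if "(f has_derivative M) (at u within fiber p)" for M
    using that by (intro has_derivative_along[OF _ \<gamma>, where M = "fiber p"]) simp_all
  from has_derivative_unique[OF this[OF L] this[OF L']] show ?thesis
    by (metis scaleR_one)
qed

abbreviation (input) uncurried ::
    "('n::finite, 'k::finite) bundle_fun
      \<Rightarrow> ((real ^ 'n) \<times> (real ^ 'n) \<times> (real ^ 'n)) \<times> (real ^ 'k) \<Rightarrow> real" where
  "uncurried F \<equiv> \<lambda>((q, \<eta>, w), c). F q \<eta> w c"

text \<open>In any chart, moving the base point from \<open>q\<close> with score \<open>h\<close> while transporting the fiber
  variables leaves \<open>(q, \<eta>, w)\<close> along \<open>horizontal_lift q \<eta> w h\<close>, whatever the origin \<open>p\<close> is.\<close>

lemma in_chart_has_derivative: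
  fixes F :: "('n::finite, 'k::finite) bundle_fun"
  assumes FG: "(uncurried F has_derivative G) (at ((q, \<eta>, w), c) within full_bundle \<times> D)"
    and c: "c \<in> D" and p: "p \<in> densities" and \<zeta>: "\<zeta> \<in> fiber p"
    and eqs: "q = exp_param p u" "\<eta> = mix_transport p q \<zeta>" "w = exp_transport p q v"
  shows "((\<lambda>u'. in_chart F p u' \<zeta> v c) has_derivative
            (\<lambda>h. G (horizontal_lift q \<eta> w (exp_transport p q h), 0))) (at u)"
proof -
  let ?\<gamma> = "\<lambda>u'. let q' = exp_param p u' in ((q', mix_transport p q' \<zeta>, exp_transport p q' v), c)"
  have q: "q \<in> densities" using eqs(1) exp_param_in_densities[OF p] by simp
  have score: "(\<chi> x. (\<chi> x. q $ x * exp_transport p q h $ x) $ x / q $ x) = exp_transport p q h"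
    for h
    using densities_pos[OF q] by (simp add: vec_eq_iff) (metis less_irrefl)
  have "((\<lambda>u'. (exp_param p u', mix_transport p (exp_param p u') \<zeta>, exp_transport p (exp_param p u') v))
      has_derivative (\<lambda>h. horizontal_lift q \<eta> w (exp_transport p q h))) (at u)"
    using has_derivative_transport[OF exp_param_has_derivative[OF p, of u], of p \<zeta> v,
        folded eqs(1), unfolded score, OF q exp_transport_in_fiber[OF q]]
    unfolding eqs(2,3) .
  then have "(?\<gamma> has_derivative (\<lambda>h. (horizontal_lift q \<eta> w (exp_transport p q h), 0))) (at u)"
    unfolding Let_def by (intro has_derivative_Pair has_derivative_const)
  moreover have "range ?\<gamma> \<subseteq> full_bundle \<times> D"
    using c p \<zeta> by (auto simp: Let_def full_bundle_def exp_param_in_densities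
        mix_transport_in_fiber exp_transport_in_fiber)
  ultimately have "((\<lambda>u'. uncurried F (?\<gamma> u')) has_derivative
      (\<lambda>h. G (horizontal_lift q \<eta> w (exp_transport p q h), 0))) (at u)"
    using FG by (intro has_derivative_along[of "uncurried F" G ?\<gamma> u "full_bundle \<times> D"])
      (simp_all add: Let_def eqs[symmetric])
  then show ?thesis by (simp add: in_chart_def Let_def)
qed

text \<open>The base gradient represents the horizontal part of the differential. One direction needs a
  single chart, the one centred at \<open>q\<close>; the other uses that all charts give the same horizontal
  derivative.\<close>

lemma base_gradient_iff:
  fixes F :: "('n::finite, 'k::finite) bundle_fun"
  assumes FG: "(uncurried F has_derivative G) (at ((q, \<eta>, w), c) within full_bundle \<times> D)"
    and z: "(q, \<eta>, w) \<in> full_bundle" "c \<in> D"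
  shows "base_gradient F q \<eta> w c g \<longleftrightarrow>
    g \<in> fiber q \<and> (\<forall>h\<in>fiber q. pairing q g h = G (horizontal_lift q \<eta> w h, 0))"
    (is "_ \<longleftrightarrow> ?R")
proof
  have q: "q \<in> densities" "\<eta> \<in> fiber q" "w \<in> fiber q"
    using z(1) by (auto simp: full_bundle_def)
  assume g: "base_gradient F q \<eta> w c g"
  have eqs: "q = exp_param q 0" "\<eta> = mix_transport q q \<eta>" "w = exp_transport q q w"
    using q by (simp_all add: exp_param_0 mix_transport_self exp_transport_self)
  have 0: "0 \<in> fiber q" by (simp add: fiber_def expect_algebra)
  from g q eqs 0 obtain L where
    L: "((\<lambda>u'. in_chart F q u' \<eta> w c) has_derivative L) (at 0 within fiber q)"
    and gL: "\<forall>h\<in>fiber q. pairing q g h = L (exp_transport q q h)"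
    unfolding base_gradient_def by blast
  have "L h = G (horizontal_lift q \<eta> w h, 0)" if h: "h \<in> fiber q" for h
    using has_derivative_fiber_unique[OF L has_derivative_at_withinI[OF
          in_chart_has_derivative[OF FG z(2) q(1,2) eqs]] 0 h]
    by (simp add: exp_transport_self[OF h])
  then show ?R
    using g gL by (simp add: base_gradient_def exp_transport_self)
next
  assume R: ?R
  have q: "q \<in> densities"
    using z(1) by (auto simp: full_bundle_def)
  show "base_gradient F q \<eta> w c g"
    unfolding base_gradient_def
  proof (intro conjI ballI impI, goal_cases)
    case (2 p u \<zeta> v)
    then have eqs: "q = exp_param p u" "\<eta> = mix_transport p q \<zeta>" "w = exp_transport p q v"
      by auto
    have "\<forall>h\<in>fiber q. pairing q g h =
        G (horizontal_lift q \<eta> w (exp_transport p q (exp_transport q p h)), 0)"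
      using R by (simp add: exp_transport_cancel[OF q])
    with has_derivative_at_withinI[OF in_chart_has_derivative[OF FG z(2) 2(1,3) eqs]]
    show ?case by blast
  qed (use R in simp)
qed

text \<open>The joint condition on \<open>(\<alpha>, \<beta>)\<close> separates into one condition for each gradient, by setting
  the other direction to zero.\<close>

lemma fiber_gradients_iff:
  fixes F :: "('n::finite, 'k::finite) bundle_fun"
  assumes FG: "(uncurried F has_derivative G) (at ((q, \<eta>, w), c) within full_bundle \<times> D)"
    and z: "(q, \<eta>, w) \<in> full_bundle" "c \<in> D"
  shows "fiber_gradients F q \<eta> w c (gm, ge) \<longleftrightarrow>
    (gm \<in> fiber q \<and> (\<forall>\<alpha>\<in>fiber q. pairing q gm \<alpha> = G ((0, \<alpha>, 0), 0))) \<and>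
    (ge \<in> fiber q \<and> (\<forall>\<beta>\<in>fiber q. pairing q ge \<beta> = G ((0, 0, \<beta>), 0)))"
proof -
  have G: "linear G" using FG by (rule has_derivative_linear)
  have split: "G ((0, \<alpha>, \<beta>), 0) = G ((0, \<alpha>, 0), 0) + G ((0, 0, \<beta>), 0)" for \<alpha> \<beta>
    by (simp add: linear_add[OF G, symmetric])
  have deriv: "((\<lambda>s. F q (\<eta> + s *\<^sub>R \<alpha>) (w + s *\<^sub>R \<beta>) c) has_real_derivative G ((0, \<alpha>, \<beta>), 0)) (at 0)"
    if "\<alpha> \<in> fiber q" "\<beta> \<in> fiber q" for \<alpha> \<beta>
  proof -
    let ?\<gamma> = "\<lambda>s::real. ((q, \<eta> + s *\<^sub>R \<alpha>, w + s *\<^sub>R \<beta>), c)"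
    have "((\<lambda>s. v + s *\<^sub>R \<alpha>) has_derivative (\<lambda>s. s *\<^sub>R \<alpha>)) (at (0::real))"
      for v \<alpha> :: "real ^ 'n"
      by (auto intro!: derivative_eq_intros)
    then have "(?\<gamma> has_derivative (\<lambda>s. ((0, s *\<^sub>R \<alpha>, s *\<^sub>R \<beta>), 0))) (at 0)"
      by (intro has_derivative_Pair has_derivative_const)
    moreover have "range ?\<gamma> \<subseteq> full_bundle \<times> D"
      using z that by (auto simp: full_bundle_def fiber_def expect_algebra)
    ultimately have "((\<lambda>s. uncurried F (?\<gamma> s)) has_derivative (\<lambda>s. G ((0, s *\<^sub>R \<alpha>, s *\<^sub>R \<beta>), 0))) (at 0)"
      using FG by (intro has_derivative_along[of "uncurried F" G ?\<gamma> 0 "full_bundle \<times> D"]) simp_all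
    moreover have "G ((0, s *\<^sub>R \<alpha>, s *\<^sub>R \<beta>), 0) = G ((0, \<alpha>, \<beta>), 0) * s" for s
      using linear_cmul[OF G, of s "((0, \<alpha>, \<beta>), 0)"] by simp
    ultimately show ?thesis by (simp add: has_field_derivative_def)
  qed
  have 0: "0 \<in> fiber q" by (simp add: fiber_def expect_algebra)
  have "(\<forall>\<alpha>\<in>fiber q. \<forall>\<beta>\<in>fiber q.
        ((\<lambda>s. F q (\<eta> + s *\<^sub>R \<alpha>) (w + s *\<^sub>R \<beta>) c) has_real_derivative
           pairing q \<alpha> gm + pairing q ge \<beta>) (at 0)) \<longleftrightarrow>
      (\<forall>\<alpha>\<in>fiber q. \<forall>\<beta>\<in>fiber q.
         G ((0, \<alpha>, 0), 0) + G ((0, 0, \<beta>), 0) = pairing q gm \<alpha> + pairing q ge \<beta>)"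
  proof (intro ball_cong refl)
    fix \<alpha> \<beta> assume *: "\<alpha> \<in> fiber q" "\<beta> \<in> fiber q"
    note d = deriv[OF *, unfolded split[of \<alpha> \<beta>]]
    show "((\<lambda>s. F q (\<eta> + s *\<^sub>R \<alpha>) (w + s *\<^sub>R \<beta>) c) has_real_derivative
           pairing q \<alpha> gm + pairing q ge \<beta>) (at 0) \<longleftrightarrow>
         G ((0, \<alpha>, 0), 0) + G ((0, 0, \<beta>), 0) = pairing q gm \<alpha> + pairing q ge \<beta>"
      unfolding pairing_commute[of q \<alpha> gm]
    proof (rule iffI)
      assume eq: "G ((0, \<alpha>, 0), 0) + G ((0, 0, \<beta>), 0) = pairing q gm \<alpha> + pairing q ge \<beta>"
      from d show "((\<lambda>s. F q (\<eta> + s *\<^sub>R \<alpha>) (w + s *\<^sub>R \<beta>) c) has_real_derivative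
           pairing q gm \<alpha> + pairing q ge \<beta>) (at 0)" unfolding eq .
    qed (rule DERIV_unique[OF d])
  qed
  also have "\<dots> \<longleftrightarrow> (\<forall>\<alpha>\<in>fiber q. pairing q gm \<alpha> = G ((0, \<alpha>, 0), 0)) \<and>
      (\<forall>\<beta>\<in>fiber q. pairing q ge \<beta> = G ((0, 0, \<beta>), 0))"
    (is "?A \<longleftrightarrow> ?B")
  proof
    have G0: "G ((0, 0, 0), 0) = 0" using linear_0[OF G] by (simp add: zero_prod_def)
    assume A: ?A
    have "pairing q gm 0 = 0" "pairing q ge 0 = 0"
      by (simp_all add: pairing_commute[of q _ 0] pairing_algebra(4))
    then show ?B
      using A[rule_format, OF _ 0] A[rule_format, OF 0] G0 by simp
  qed simp
  finally show ?thesis by (auto simp: fiber_gradients_def)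
qed

lemma nabla_iff:
  fixes F :: "('n::finite, 'k::finite) bundle_fun"
  assumes FG: "(uncurried F has_derivative G) (at ((q, \<eta>, w), c) within full_bundle \<times> D)"
    and z: "(q, \<eta>, w) \<in> full_bundle" "c \<in> D" and D: "open D"
  shows "GDERIV (F q \<eta> w) c :> g \<longleftrightarrow> (\<forall>k. g \<bullet> k = G (0, k))"
proof -
  let ?\<gamma> = "\<lambda>c'. ((q, \<eta>, w), c')"
  have "(?\<gamma> has_derivative (\<lambda>k. (0, k))) (at c within D)"
    by (intro has_derivative_Pair has_derivative_const has_derivative_ident)
  then have "((\<lambda>c'. uncurried F (?\<gamma> c')) has_derivative (\<lambda>k. G (0, k))) (at c within D)"
    using FG z by (intro has_derivative_along[of "uncurried F" G ?\<gamma> c "full_bundle \<times> D"]) auto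
  then have d: "(F q \<eta> w has_derivative (\<lambda>k. G (0, k))) (at c)"
    using at_within_open[OF z(2) D] by simp
  show ?thesis
    unfolding gderiv_def inner_commute[of g]
  proof
    assume "(F q \<eta> w has_derivative (\<lambda>k. k \<bullet> g)) (at c)"
    from fun_cong[OF has_derivative_unique[OF this d]] show "\<forall>k. k \<bullet> g = G (0, k)" by blast
  qed (use d in simp)
qed

lemma ex1_gradients:
  fixes F :: "('n::finite, 'k::finite) bundle_fun"
  assumes FG: "(uncurried F has_derivative G) (at ((q, \<eta>, w), c) within full_bundle \<times> D)"
    and z: "(q, \<eta>, w) \<in> full_bundle" "c \<in> D" and D: "open D"
  shows "\<exists>!g. base_gradient F q \<eta> w c g"
    and "\<exists>!gs. fiber_gradients F q \<eta> w c gs"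
    and "\<exists>!g. GDERIV (F q \<eta> w) c :> g"
proof -
  have q: "q \<in> densities" using z(1) by (auto simp: full_bundle_def)
  have G: "linear G" using FG by (rule has_derivative_linear)
  note linear_G = linear_compose[OF _ G, unfolded o_def]
  show "\<exists>!g. base_gradient F q \<eta> w c g"
    unfolding base_gradient_iff[OF FG z]
    by (rule fiber_Riesz[OF q linear_G])
      (rule linearI; simp add: linear_add[OF linear_horizontal_lift] linear_cmul[OF linear_horizontal_lift])
  define A where "A gm \<longleftrightarrow> gm \<in> fiber q \<and> (\<forall>\<alpha>\<in>fiber q. pairing q gm \<alpha> = G ((0, \<alpha>, 0), 0))" for gm
  define B where "B ge \<longleftrightarrow> ge \<in> fiber q \<and> (\<forall>\<beta>\<in>fiber q. pairing q ge \<beta> = G ((0, 0, \<beta>), 0))" for ge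
  have AB: "fiber_gradients F q \<eta> w c gs \<longleftrightarrow> A (fst gs) \<and> B (snd gs)" for gs
    unfolding A_def B_def by (subst fiber_gradients_iff[OF FG z, symmetric]) simp
  have "\<exists>!gm. A gm"
    unfolding A_def by (rule fiber_Riesz[OF q linear_G]) (rule linearI; simp)
  moreover have "\<exists>!ge. B ge"
    unfolding B_def by (rule fiber_Riesz[OF q linear_G]) (rule linearI; simp)
  ultimately show "\<exists>!gs. fiber_gradients F q \<eta> w c gs"
    unfolding AB by (metis prod.collapse fst_conv snd_conv)
  have "linear (\<lambda>k. G (0, k))"
    by (rule linear_G) (rule linearI; simp)
  from adjoint_works[OF this, of _ 1]
  have "adjoint (\<lambda>k. G (0, k)) 1 \<bullet> k = G (0, k)" for k
    by (simp add: inner_commute)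
  then show "\<exists>!g. GDERIV (F q \<eta> w) c :> g"
    unfolding nabla_iff[OF FG z D]
  proof (intro ex1I[of _ "adjoint (\<lambda>k. G (0, k)) 1"])
    fix g assume "\<forall>k. g \<bullet> k = G (0, k)"
    with \<open>\<And>k. adjoint (\<lambda>k. G (0, k)) 1 \<bullet> k = G (0, k)\<close>
    have "\<forall>k. g \<bullet> k = adjoint (\<lambda>k. G (0, k)) 1 \<bullet> k" by simp
    then show "g = adjoint (\<lambda>k. G (0, k)) 1" by (rule vector_eq_rdot[THEN iffD1])
  qed simp
qed

lemma gradients:
  fixes F :: "('n::finite, 'k::finite) bundle_fun"
  assumes FG: "(uncurried F has_derivative G) (at ((q, \<eta>, w), c) within full_bundle \<times> D)"
    and z: "(q, \<eta>, w) \<in> full_bundle" "c \<in> D" and D: "open D"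
  shows "base_gradient F q \<eta> w c (Grad F q \<eta> w c)"
    and "fiber_gradients F q \<eta> w c (Grad_m F q \<eta> w c, Grad_e F q \<eta> w c)"
    and "GDERIV (F q \<eta> w) c :> nabla F q \<eta> w c"
proof -
  note ex1 = ex1_gradients[OF assms]
  show "base_gradient F q \<eta> w c (Grad F q \<eta> w c)"
    unfolding Grad_def by (rule theI'[OF ex1(1)])
  show "fiber_gradients F q \<eta> w c (Grad_m F q \<eta> w c, Grad_e F q \<eta> w c)"
    unfolding Grad_m_def Grad_e_def prod.collapse by (rule theI'[OF ex1(2)])
  show "GDERIV (F q \<eta> w) c :> nabla F q \<eta> w c"
    unfolding nabla_def by (rule theI'[OF ex1(3)])
qed

section \<open>Curves in the bundle\<close>

text \<open>The differentiated form of a constraint \<open>expect q f = a\<close> such as those that define the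
  densities (\<open>f = 1\<close>) and the fibers (\<open>a = 0\<close>).\<close>

lemma expect_along_curve:
  fixes q f :: "real \<Rightarrow> real ^ 'n::finite"
  assumes d: "(q has_vector_derivative q') (at t)" "(f has_vector_derivative f') (at t)"
    and I: "open I" "t \<in> I" and const: "\<And>s. s \<in> I \<Longrightarrow> expect (q s) (f s) = a"
  shows "expect (q t) f' + expect q' (f t) = 0"
proof -
  have "((\<lambda>s. expect (q s) (f s)) has_derivative
      (\<lambda>h. expect (q t) (h *\<^sub>R f') + expect (h *\<^sub>R q') (f t))) (at t)"
    by (rule has_derivative_expect[OF d[unfolded has_vector_derivative_def]])
  moreover have "((\<lambda>s. expect (q s) (f s)) has_derivative (\<lambda>h. 0)) (at t)"
    by (rule has_derivative_transform_within_open[OF has_derivative_const I]) (simp add: const)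
  ultimately have "(\<lambda>h. expect (q t) (h *\<^sub>R f') + expect (h *\<^sub>R q') (f t)) = (\<lambda>h. 0)"
    by (rule has_derivative_unique)
  from fun_cong[OF this, of 1] show ?thesis by simp
qed

lemma velocity_in_fiber:
  fixes q :: "real \<Rightarrow> real ^ 'n::finite"
  assumes d: "(q has_vector_derivative vector_derivative q (at t)) (at t)"
    and I: "open I" "t \<in> I" and q: "\<And>s. s \<in> I \<Longrightarrow> q s \<in> densities"
  shows "velocity q t \<in> fiber (q t)"
proof -
  have "expect (vector_derivative q (at t)) (\<chi> x. 1) = 0"
    using expect_along_curve[OF d has_vector_derivative_const I, of "\<chi> x. 1" 1] q
    by (simp add: expect_const expect_algebra)
  then have "pairing (q t) (\<chi> x. 1) (velocity q t) = 0"
    unfolding velocity_def expect_pairing[OF q[OF I(2)], of "vector_derivative q (at t)"] .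
  then show ?thesis by (simp add: pairing_def fiber_def)
qed

text \<open>The covariant derivatives are what remains of the fiber derivatives once the horizontal part is
  removed; that they are tangent to the fiber is the differentiated constraint
  that \<open>\<eta>\<close> and \<open>w\<close> have mean zero. For \<open>w\<close> this constraint also says that the constant removed by
  the exponential covariant derivative is exactly the horizontal one.\<close>

lemma bundle_curve_derivative:
  fixes q \<eta> w :: "real \<Rightarrow> real ^ 'n::finite"
  assumes d: "(q has_vector_derivative vector_derivative q (at t)) (at t)"
      "(\<eta> has_vector_derivative vector_derivative \<eta> (at t)) (at t)"
      "(w has_vector_derivative vector_derivative w (at t)) (at t)"
    and I: "open I" "t \<in> I" and z: "\<And>s. s \<in> I \<Longrightarrow> (q s, \<eta> s, w s) \<in> full_bundle"
  shows "mix_covariant q \<eta> t \<in> fiber (q t)"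
    and "exp_covariant q w t \<in> fiber (q t)"
    and "(vector_derivative q (at t), vector_derivative \<eta> (at t), vector_derivative w (at t)) =
      horizontal_lift (q t) (\<eta> t) (w t) (velocity q t)
        + (0, mix_covariant q \<eta> t, exp_covariant q w t)"
proof -
  have q: "q t \<in> densities" and q0: "q t $ x \<noteq> 0" for x
    using z[OF I(2)] densities_pos[of "q t" x] by (auto simp: full_bundle_def)
  have eta: "expect (q t) (vector_derivative \<eta> (at t)) = - pairing (q t) (\<eta> t) (velocity q t)"
    using expect_along_curve[OF d(1,2) I, of 0] z
    by (simp add: full_bundle_def fiber_def expect_pairing[OF q, of "vector_derivative q (at t)"]
        velocity_def add_eq_0_iff2)
  have w: "expect (q t) (vector_derivative w (at t)) = - pairing (q t) (w t) (velocity q t)"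
    using expect_along_curve[OF d(1,3) I, of 0] z
    by (simp add: full_bundle_def fiber_def expect_pairing[OF q, of "vector_derivative q (at t)"]
        velocity_def add_eq_0_iff2)
  have "mix_covariant q \<eta> t = (\<chi> x. \<eta> t $ x * velocity q t $ x) + vector_derivative \<eta> (at t)"
    by (simp add: mix_covariant_def vec_eq_iff)
  then show "mix_covariant q \<eta> t \<in> fiber (q t)"
    using eta by (simp add: fiber_def expect_algebra pairing_def)
  have "exp_covariant q w t = exp_transport (q t) (q t) (vector_derivative w (at t))"
    by (simp add: exp_covariant_def exp_transport_def)
  then show "exp_covariant q w t \<in> fiber (q t)"
    using exp_transport_in_fiber[OF q] by simp
  show "(vector_derivative q (at t), vector_derivative \<eta> (at t), vector_derivative w (at t)) =
      horizontal_lift (q t) (\<eta> t) (w t) (velocity q t)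
        + (0, mix_covariant q \<eta> t, exp_covariant q w t)"
    using q0 by (simp add: horizontal_lift_def vec_eq_iff velocity_def[of q t] mix_covariant_def
        exp_covariant_def w[unfolded velocity_def])
qed

lemma smooth_curve_has_derivative:
  assumes "smooth_curve I \<gamma> M" "t \<in> I"
  obtains \<gamma>' where "(\<gamma> has_derivative \<gamma>') (at t)"
  using assms smooth_on_has_derivative[of \<gamma> I t] unfolding smooth_curve_def
  by (metis at_within_open)

lemma has_vector_derivative_of_has_derivative:
  "(f has_derivative f') (at t) \<Longrightarrow> (f has_vector_derivative vector_derivative f (at t)) (at t)"
  by (metis differentiableI vector_derivative_works)

text \<open>Transported fiber variables move horizontally, so along them only the horizontal part of the
  differential of \<open>F\<close> survives, and this is what \<open>Grad F\<close> represents.\<close>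

lemma natural_gradient_transported:
  fixes F :: "('n::finite, 'k::finite) bundle_fun"
  assumes F: "smooth_on (uncurried F) (full_bundle \<times> D)" and D: "open D"
    and p: "p \<in> densities" "\<zeta> \<in> fiber p" and c: "c \<in> D"
  shows "natural_gradient
          (\<lambda>q. F q (mix_transport p q \<zeta>) (exp_transport p q v) c)
          (\<lambda>q. Grad F q (mix_transport p q \<zeta>) (exp_transport p q v) c)"
proof -
  let ?e = "\<lambda>q. (q, mix_transport p q \<zeta>, exp_transport p q v)"
  have e: "?e q \<in> full_bundle" if "q \<in> densities" for q
    using that p by (simp add: full_bundle_def mix_transport_in_fiber exp_transport_in_fiber)
  have grad: "\<exists>G. (uncurried F has_derivative G) (at (?e q, c) within full_bundle \<times> D) \<and>
      base_gradient F q (mix_transport p q \<zeta>) (exp_transport p q v) c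
        (Grad F q (mix_transport p q \<zeta>) (exp_transport p q v) c)" if q: "q \<in> densities" for q
  proof -
    obtain G where G: "(uncurried F has_derivative G) (at (?e q, c) within full_bundle \<times> D)"
      using smooth_on_has_derivative[OF F, of "(?e q, c)"] e[OF q] c by blast
    with gradients(1)[OF G e[OF q] c D] show ?thesis by blast
  qed
  show ?thesis
    unfolding natural_gradient_def
  proof (intro conjI ballI allI impI)
    fix q :: "real ^ 'n" assume "q \<in> densities"
    from grad[OF this] show "Grad F q (mix_transport p q \<zeta>) (exp_transport p q v) c \<in> fiber q"
      by (auto simp: base_gradient_def)
  next
    fix I t and q :: "real \<Rightarrow> real ^ 'n"
    assume q: "smooth_curve I q densities" and t: "t \<in> I"
    then have I: "open I" and qI: "\<And>s. s \<in> I \<Longrightarrow> q s \<in> densities"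
      by (auto simp: smooth_curve_def)
    note qt = qI[OF t]
    from grad[OF qt] obtain G where
      G: "(uncurried F has_derivative G) (at (?e (q t), c) within full_bundle \<times> D)" and
      g: "base_gradient F (q t) (mix_transport p (q t) \<zeta>) (exp_transport p (q t) v) c
        (Grad F (q t) (mix_transport p (q t) \<zeta>) (exp_transport p (q t) v) c)"
      by blast
    let ?H = "horizontal_lift (q t) (mix_transport p (q t) \<zeta>) (exp_transport p (q t) v)"
    obtain q' where "(q has_derivative q') (at t)"
      using smooth_curve_has_derivative[OF q t] .
    then have d: "(q has_vector_derivative vector_derivative q (at t)) (at t)"
      by (rule has_vector_derivative_of_has_derivative)
    have v: "velocity q t \<in> fiber (q t)"
      using velocity_in_fiber[OF d I t qI] .
    have score: "(\<chi> x. (h *\<^sub>R vector_derivative q (at t)) $ x / q t $ x) = h *\<^sub>R velocity q t" for h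
      by (simp add: velocity_def vec_eq_iff)
    have "((\<lambda>s. ?e (q s)) has_derivative (\<lambda>h. ?H (h *\<^sub>R velocity q t))) (at t within I)"
      using has_derivative_transport[OF d[unfolded has_vector_derivative_def, THEN has_derivative_at_withinI] qt]
        v unfolding score by (simp add: fiber_def expect_algebra)
    from has_derivative_Pair[OF this has_derivative_const[of c]]
    have "((\<lambda>s. uncurried F (?e (q s), c)) has_derivative
        (\<lambda>h. G (?H (h *\<^sub>R velocity q t), 0))) (at t within I)"
      by (rule has_derivative_along[of "uncurried F" G "\<lambda>s. (?e (q s), c)" t "full_bundle \<times> D", rotated])
        (use G e qI c in auto)
    moreover have "G (?H (h *\<^sub>R velocity q t), 0) =
      pairing (q t) (Grad F (q t) (mix_transport p (q t) \<zeta>) (exp_transport p (q t) v) c)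
        (velocity q t) * h" for h
    proof -
      have "G (?H (h *\<^sub>R velocity q t), 0) = h * G (?H (velocity q t), 0)"
        using linear_cmul[OF has_derivative_linear[OF G], of h "(?H (velocity q t), 0)"]
        by (simp add: linear_cmul[OF linear_horizontal_lift])
      then show ?thesis
        using g v unfolding base_gradient_iff[OF G e[OF qt] c] by simp
    qed
    ultimately show "((\<lambda>s. F (q s) (mix_transport p (q s) \<zeta>) (exp_transport p (q s) v) c)
        has_real_derivative
        pairing (q t) (Grad F (q t) (mix_transport p (q t) \<zeta>) (exp_transport p (q t) v) c)
          (velocity q t)) (at t)"
      by (simp only: has_field_derivative_def at_within_open[OF t I] split_conv)
  qed
qed

text \<open>The velocity of the curve splits into its horizontal part, the two covariant derivatives and the
  velocity of the parameter; the differential of \<open>F\<close> acts on each of them by the gradient that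
  represents it there.\<close>

lemma has_derivative_along_bundle_curve:
  fixes F :: "('n::finite, 'k::finite) bundle_fun"
  assumes F: "smooth_on (uncurried F) (full_bundle \<times> D)" and D: "open D"
    and \<gamma>: "smooth_curve I (\<lambda>t. ((q t, \<eta> t, w t), c t)) (full_bundle \<times> D)" and t: "t \<in> I"
  shows "((\<lambda>s. F (q s) (\<eta> s) (w s) (c s)) has_real_derivative
              pairing (q t) (Grad F (q t) (\<eta> t) (w t) (c t)) (velocity q t)
              + pairing (q t) (mix_covariant q \<eta> t) (Grad_m F (q t) (\<eta> t) (w t) (c t))
              + pairing (q t) (Grad_e F (q t) (\<eta> t) (w t) (c t)) (exp_covariant q w t)
              + nabla F (q t) (\<eta> t) (w t) (c t) \<bullet> vector_derivative c (at t)) (at t)"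
proof -
  have I: "open I" and z: "\<And>s. s \<in> I \<Longrightarrow> (q s, \<eta> s, w s) \<in> full_bundle"
    and cI: "\<And>s. s \<in> I \<Longrightarrow> c s \<in> D"
    using \<gamma> by (auto simp: smooth_curve_def)
  have qI: "\<And>s. s \<in> I \<Longrightarrow> q s \<in> densities" using z by (auto simp: full_bundle_def)
  obtain G where G: "(uncurried F has_derivative G)
      (at ((q t, \<eta> t, w t), c t) within full_bundle \<times> D)"
    using smooth_on_has_derivative[OF F, of "((q t, \<eta> t, w t), c t)"] z[OF t] cI[OF t] by blast
  have lin: "linear G" using G by (rule has_derivative_linear)
  obtain \<gamma>' where "((\<lambda>t. ((q t, \<eta> t, w t), c t)) has_derivative \<gamma>') (at t)"
    using smooth_curve_has_derivative[OF \<gamma> t] .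
  note d0 = has_derivative_fst[OF this, unfolded fst_conv] has_derivative_snd[OF this, unfolded snd_conv]
  note d = has_derivative_fst[OF d0(1), unfolded fst_conv]
    has_derivative_fst[OF has_derivative_snd[OF d0(1)], unfolded fst_conv snd_conv]
    has_derivative_snd[OF has_derivative_snd[OF d0(1)], unfolded snd_conv] d0(2)
  note d = d[THEN has_vector_derivative_of_has_derivative]
  let ?q' = "vector_derivative q (at t)" and ?\<eta>' = "vector_derivative \<eta> (at t)"
    and ?w' = "vector_derivative w (at t)" and ?c' = "vector_derivative c (at t)"
  let ?H = "horizontal_lift (q t) (\<eta> t) (w t) (velocity q t)"
  note decomp = bundle_curve_derivative[OF d(1-3) I t z]
  have "((\<lambda>s. ((q s, \<eta> s, w s), c s)) has_derivative (\<lambda>h. h *\<^sub>R ((?q', ?\<eta>', ?w'), ?c'))) (at t within I)"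
    unfolding scaleR_Pair
    by (rule has_derivative_at_withinI,
        intro has_derivative_Pair d[unfolded has_vector_derivative_def])
  then have "((\<lambda>s. uncurried F ((q s, \<eta> s, w s), c s)) has_derivative
      (\<lambda>h. G (h *\<^sub>R ((?q', ?\<eta>', ?w'), ?c')))) (at t within I)"
    by (rule has_derivative_along[of "uncurried F" G "\<lambda>s. ((q s, \<eta> s, w s), c s)" t
          "full_bundle \<times> D", rotated]) (use G z cI in auto)
  moreover have "G (h *\<^sub>R ((?q', ?\<eta>', ?w'), ?c')) = G ((?q', ?\<eta>', ?w'), ?c') * h" for h
    by (simp only: linear_cmul[OF lin] real_scaleR_def mult.commute)
  ultimately have "((\<lambda>s. F (q s) (\<eta> s) (w s) (c s)) has_real_derivative
      G ((?q', ?\<eta>', ?w'), ?c')) (at t)"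
    by (simp only: has_field_derivative_def at_within_open[OF t I] split_conv)
  also have "((?q', ?\<eta>', ?w'), ?c') = (?H, 0) + ((0, mix_covariant q \<eta> t, 0), 0)
      + ((0, 0, exp_covariant q w t), 0) + (0, ?c')"
    using decomp(3) by (cases ?H) simp
  also have "G \<dots> = G (?H, 0) + G ((0, mix_covariant q \<eta> t, 0), 0)
      + G ((0, 0, exp_covariant q w t), 0) + G (0, ?c')"
    by (simp only: linear_add[OF lin])
  also have "\<dots> = pairing (q t) (Grad F (q t) (\<eta> t) (w t) (c t)) (velocity q t)
      + pairing (q t) (mix_covariant q \<eta> t) (Grad_m F (q t) (\<eta> t) (w t) (c t))
      + pairing (q t) (Grad_e F (q t) (\<eta> t) (w t) (c t)) (exp_covariant q w t)
      + nabla F (q t) (\<eta> t) (w t) (c t) \<bullet> ?c'"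
    using gradients[OF G z[OF t] cI[OF t] D] decomp(1,2) velocity_in_fiber[OF d(1) I t qI]
    unfolding base_gradient_iff[OF G z[OF t] cI[OF t]] fiber_gradients_iff[OF G z[OF t] cI[OF t]]
      nabla_iff[OF G z[OF t] cI[OF t] D]
    by (simp add: pairing_commute[of "q t" "mix_covariant q \<eta> t"])
  finally show ?thesis .
qed

theorem proposition4p1:
  fixes D :: "(real ^ 'k::finite) set"
    and F :: "real ^ 'n::finite \<Rightarrow> real ^ 'n \<Rightarrow> real ^ 'n \<Rightarrow> real ^ 'k \<Rightarrow> real"
  assumes "open D" and "connected D" and "D \<noteq> {}"
    and "smooth_on (\<lambda>((q, \<eta>, w), c). F q \<eta> w c) (full_bundle \<times> D)"
  shows
    "(\<forall>q \<eta> w. \<forall>c\<in>D. (q, \<eta>, w) \<in> full_bundle \<longrightarrow>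
        (\<exists>!g. base_gradient F q \<eta> w c g) \<and>
        (\<exists>!gs. fiber_gradients F q \<eta> w c gs) \<and>
        (\<exists>!g. GDERIV (F q \<eta> w) c :> g) \<and>
        base_gradient F q \<eta> w c (Grad F q \<eta> w c) \<and>
        fiber_gradients F q \<eta> w c (Grad_m F q \<eta> w c, Grad_e F q \<eta> w c) \<and>
        GDERIV (F q \<eta> w) c :> nabla F q \<eta> w c) \<and>
     (\<forall>p\<in>densities. \<forall>\<zeta>\<in>fiber p. \<forall>v\<in>fiber p. \<forall>c\<in>D.
        natural_gradient
          (\<lambda>q. F q (mix_transport p q \<zeta>) (exp_transport p q v) c)
          (\<lambda>q. Grad F q (mix_transport p q \<zeta>) (exp_transport p q v) c)) \<and>
     (\<forall>I q \<eta> w c. smooth_curve I (\<lambda>t. ((q t, \<eta> t, w t), c t)) (full_bundle \<times> D) \<longrightarrow>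
        (\<forall>t\<in>I.
           ((\<lambda>s. F (q s) (\<eta> s) (w s) (c s)) has_real_derivative
              pairing (q t) (Grad F (q t) (\<eta> t) (w t) (c t)) (velocity q t)
              + pairing (q t) (mix_covariant q \<eta> t) (Grad_m F (q t) (\<eta> t) (w t) (c t))
              + pairing (q t) (Grad_e F (q t) (\<eta> t) (w t) (c t)) (exp_covariant q w t)
              + nabla F (q t) (\<eta> t) (w t) (c t) \<bullet> vector_derivative c (at t)) (at t)))"
proof -
  have base: "(\<exists>!g. base_gradient F q \<eta> w c g) \<and>
        (\<exists>!gs. fiber_gradients F q \<eta> w c gs) \<and>
        (\<exists>!g. GDERIV (F q \<eta> w) c :> g) \<and>
        base_gradient F q \<eta> w c (Grad F q \<eta> w c) \<and>
        fiber_gradients F q \<eta> w c (Grad_m F q \<eta> w c, Grad_e F q \<eta> w c) \<and>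
        GDERIV (F q \<eta> w) c :> nabla F q \<eta> w c"
    if z: "(q, \<eta>, w) \<in> full_bundle" "c \<in> D" for q \<eta> w c
  proof -
    obtain G where G: "(uncurried F has_derivative G) (at ((q, \<eta>, w), c) within full_bundle \<times> D)"
      using smooth_on_has_derivative[OF assms(4), of "((q, \<eta>, w), c)"] z by blast
    show ?thesis
      using ex1_gradients[OF G z assms(1)] gradients[OF G z assms(1)] by blast
  qed
  show ?thesis
    using base natural_gradient_transported[OF assms(4,1)]
      has_derivative_along_bundle_curve[OF assms(4,1)] by blast
qed

end
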